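(* There exist $\epsilon_0>0$ and $C_0>0$ such that if $G\in C^\infty_{c}(\mathbb R^{2n};\mathbb R)$ and $\|G\|_{C^2}<\epsilon_0$, then $$\frac1{C_0}\|T_\Lambda v\|_{L^2_\Lambda}\le\|Tv\|_{L^2_\varphi}\le C_0\|T_\Lambda v\|_{L^2_\Lambda},\qquad v\in L^2(\mathbb R^n),$$ (with $C_0$ independent of the semiclassical parameter $h$), where $$L^2_\Lambda:=L^2(\Lambda,e^{-2H(x,\xi)/h}\,dx\,d\xi),\qquad L^2_\varphi:=L^2(T^*\mathbb R^n,e^{-2\varphi(x,\xi)/h}\,dx\,d\xi),$$ $\Lambda=\Lambda_G$, $T_\Lambda$, $H$ are the deformation, deformed FBI transform and weight associated to $G$, and $\varphi$ is given implicitly by $$\varphi(x,\xi)=\max_{(x',\xi')\in\mathbb R^{2n}}\Big(-\operatorname{Im}\,\mathrm{c.v.}_y\big(\Phi(x,\xi,y)-\bar\Phi(z,\zeta,y)\big)\big|_{z=x'+iG_\xi(x',\xi'),\ \zeta=\xi'-iG_x(x',\xi')}+H(x',\xi')\Big).$$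
   Context: $h>0$ is a small semiclassical parameter. The FBI transform is $$Tu(x,\xi)=c\,h^{-\frac{3n}4}\int_{\mathbb R^n}e^{\frac ih(\langle x-y,\xi\rangle+\frac i2(x-y)^2)}u(y)\,dy,\qquad c=2^{-n/2}\pi^{-3n/4},$$ where $v^2:=v_1^2+\dots+v_n^2$ for $v\in\mathbb C^n$; $Tu$ extends holomorphically to $(x,\xi)\in\mathbb C^{2n}$. For $G\in C_c^\infty(\mathbb R^{2n};\mathbb R)$, $$\Lambda=\Lambda_G:=\{(x+iG_\xi(x,\xi),\xi-iG_x(x,\xi)):(x,\xi)\in\mathbb R^{2n}\}$$ is parametrized by $(x,\xi)\in\mathbb R^{2n}$; functions on $\Lambda$ are identified with functions of $(x,\xi)$, and $$T_\Lambda u(x,\xi):=Tu(x+iG_\xi(x,\xi),\xi-iG_x(x,\xi)),\qquad H(x,\xi):=G(x,\xi)-\xi\cdot G_\xi(x,\xi)$$ (so that $dH=-\operatorname{Im}\zeta\cdot dz|_\Lambda$). The phases are $$\Phi(z,\zeta,y)=\langle z-y,\zeta\rangle+\tfrac i2(z-y)^2,\qquad \bar\Phi(z,\zeta,y)=\langle z-y,\zeta\rangle-\tfrac i2(z-y)^2 ,$$ with complex bilinear $\langle\cdot,\cdot\rangle$. $\mathrm{c.v.}_y$ denotes the critical value of the (non-degenerate quadratic) function of $y\in\mathbb C^n$. *)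

theory Defs
  imports "HOL-Analysis.Analysis"
begin

text \<open>The phase space \<open>T\<^sup>*\<real>\<^sup>n\<close> is \<^typ>\<open>(real^'n) \<times> (real^'n)\<close>, with points \<open>(x, \<xi>)\<close>;
  the dimension is \<open>n = CARD('n)\<close>.\<close>

section \<open>Smooth functions and the \<open>C\<^sup>k\<close> norm\<close>

fun iter_deriv :: "'a::euclidean_space list \<Rightarrow> ('a \<Rightarrow> real) \<Rightarrow> 'a \<Rightarrow> real" where
  "iter_deriv [] f = f"
| "iter_deriv (b # bs) f = (\<lambda>p. frechet_derivative (iter_deriv bs f) (at p) b)"

text \<open>Differentiability of every iterated partial derivative also gives its continuity,
  so the following is \<open>C\<^sub>c\<^sup>\<infinity>\<close>.\<close>

definition Cc_infinity :: "('a::euclidean_space \<Rightarrow> real) set" where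
  "Cc_infinity = {f. (\<forall>bs. set bs \<subseteq> Basis \<longrightarrow> iter_deriv bs f differentiable_on UNIV) \<and>
                     compact (closure {p. f p \<noteq> 0})}"

text \<open>The supremum is taken in the reals; it is meaningful for functions whose derivatives up to
  order \<open>k\<close> are bounded, in particular on \<^const>\<open>Cc_infinity\<close>.\<close>

definition Ck_norm :: "nat \<Rightarrow> ('a::euclidean_space \<Rightarrow> real) \<Rightarrow> real" where
  "Ck_norm k f =
     (SUP (bs, p) \<in> {bs. set bs \<subseteq> Basis \<and> length bs \<le> k} \<times> UNIV. \<bar>iter_deriv bs f p\<bar>)"

definition grad_x :: "((real^'n) \<times> (real^'n) \<Rightarrow> real) \<Rightarrow> (real^'n) \<times> (real^'n) \<Rightarrow> real^'n" where
  "grad_x G p = (\<chi> i. frechet_derivative G (at p) (axis i 1, 0))"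

definition grad_\<xi> :: "((real^'n) \<times> (real^'n) \<Rightarrow> real) \<Rightarrow> (real^'n) \<times> (real^'n) \<Rightarrow> real^'n" where
  "grad_\<xi> G p = (\<chi> i. frechet_derivative G (at p) (0, axis i 1))"

section \<open>The phases and the FBI transform\<close>

definition cvec :: "real^'n \<Rightarrow> complex^'n" where
  "cvec x = (\<chi> i. complex_of_real (x $ i))"

text \<open>Complex bilinear (not Hermitian) pairing.\<close>

definition cdot :: "complex^'n \<Rightarrow> complex^'n \<Rightarrow> complex" where
  "cdot z w = (\<Sum>i\<in>UNIV. z $ i * w $ i)"

definition \<Phi> :: "complex^'n \<Rightarrow> complex^'n \<Rightarrow> complex^'n \<Rightarrow> complex" where
  "\<Phi> z \<zeta> y = cdot (z - y) \<zeta> + \<i> / 2 * cdot (z - y) (z - y)"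

definition \<Phi>_bar :: "complex^'n \<Rightarrow> complex^'n \<Rightarrow> complex^'n \<Rightarrow> complex" where
  "\<Phi>_bar z \<zeta> y = cdot (z - y) \<zeta> - \<i> / 2 * cdot (z - y) (z - y)"

definition L2 :: "(real^'n \<Rightarrow> complex) set" where
  "L2 = {u. u \<in> borel_measurable lebesgue \<and> integrable lebesgue (\<lambda>y. (cmod (u y))\<^sup>2)}"

text \<open>For \<open>u\<close> in \<^const>\<open>L2\<close> the integral converges absolutely for all complex \<open>(z, \<zeta>)\<close>, so the
  same formula gives the holomorphic extension of \<open>Tu\<close>.\<close>

definition FBI :: "real \<Rightarrow> (real^'n \<Rightarrow> complex) \<Rightarrow> complex^'n \<Rightarrow> complex^'n \<Rightarrow> complex" where
  "FBI h u z \<zeta> =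
     of_real (2 powr (- real CARD('n) / 2) * pi powr (- 3 * real CARD('n) / 4)
              * h powr (- 3 * real CARD('n) / 4))
     * (LINT y|lebesgue. exp (\<i> / of_real h * \<Phi> z \<zeta> (cvec y)) * u y)"

definition FBI_real :: "real \<Rightarrow> (real^'n \<Rightarrow> complex) \<Rightarrow> (real^'n) \<times> (real^'n) \<Rightarrow> complex" where
  "FBI_real h u = (\<lambda>(x, \<xi>). FBI h u (cvec x) (cvec \<xi>))"

section \<open>The deformation associated to \<open>G\<close>\<close>

definition Lambda_z :: "((real^'n) \<times> (real^'n) \<Rightarrow> real) \<Rightarrow> (real^'n) \<times> (real^'n) \<Rightarrow> complex^'n" where
  "Lambda_z G p = cvec (fst p) + \<i> *s cvec (grad_\<xi> G p)"

definition Lambda_\<zeta> :: "((real^'n) \<times> (real^'n) \<Rightarrow> real) \<Rightarrow> (real^'n) \<times> (real^'n) \<Rightarrow> complex^'n" where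
  "Lambda_\<zeta> G p = cvec (snd p) - \<i> *s cvec (grad_x G p)"

definition T_Lambda ::
  "((real^'n) \<times> (real^'n) \<Rightarrow> real) \<Rightarrow> real \<Rightarrow> (real^'n \<Rightarrow> complex) \<Rightarrow> (real^'n) \<times> (real^'n) \<Rightarrow> complex"
  where "T_Lambda G h u p = FBI h u (Lambda_z G p) (Lambda_\<zeta> G p)"

definition H_weight :: "((real^'n) \<times> (real^'n) \<Rightarrow> real) \<Rightarrow> (real^'n) \<times> (real^'n) \<Rightarrow> real" where
  "H_weight G p = G p - snd p \<bullet> grad_\<xi> G p"

text \<open>For a holomorphic function a point is critical iff the real Frechet derivative vanishes.\<close>

definition critical_value :: "(complex^'n \<Rightarrow> complex) \<Rightarrow> complex" where
  "critical_value f = (THE w. \<exists>y. (f has_derivative (\<lambda>_. 0)) (at y) \<and> w = f y)"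

text \<open>\<^const>\<open>Greatest\<close> is used for the maximum of a set of reals.\<close>

definition \<phi>_weight :: "((real^'n) \<times> (real^'n) \<Rightarrow> real) \<Rightarrow> (real^'n) \<times> (real^'n) \<Rightarrow> real" where
  "\<phi>_weight G = (\<lambda>(x, \<xi>). GREATEST m. m \<in> range (\<lambda>q.
       - Im (critical_value (\<lambda>y. \<Phi> (cvec x) (cvec \<xi>) y - \<Phi>_bar (Lambda_z G q) (Lambda_\<zeta> G q) y))
       + H_weight G q))"

text \<open>The norm of \<open>L\<^sup>2(e\<^bsup>-2w/h\<^esup> dx d\<xi>)\<close>, with values in \<open>[0, \<infinity>]\<close>.\<close>

definition weighted_L2_norm ::
  "real \<Rightarrow> ((real^'n) \<times> (real^'n) \<Rightarrow> real) \<Rightarrow> ((real^'n) \<times> (real^'n) \<Rightarrow> complex) \<Rightarrow> ennreal" where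
  "weighted_L2_norm h w f =
     (let I = (\<integral>\<^sup>+ p. ennreal ((cmod (f p))\<^sup>2 * exp (- 2 * w p / h)) \<partial>lebesgue)
      in if I = \<infinity> then \<infinity> else ennreal (sqrt (enn2real I)))"

end

theory Submission
  imports Defs
begin

text \<open>Completing the square in the phase gives
  \<open>T u(z, \<zeta>) = c h\<^bsup>-3n/4\<^esup> e\<^bsup>-\<zeta>\<^sup>2/2h\<^esup> F(z - i\<zeta>)\<close> with \<open>F\<close> the entire function
  \<open>F(w) = \<integral> e\<^bsup>-(w - y)\<^sup>2/2h\<^esup> u(y) dy\<close>.
  On \<open>\<Lambda>\<close> the argument \<open>z - i\<zeta>\<close> is the point \<open>\<kappa>(q) = q - \<nabla>G(q)\<close> of \<open>\<real>\<^sup>2\<^sup>n = \<complex>\<^sup>n\<close>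
  (with \<open>(x, \<xi>)\<close> read as \<open>x - i\<xi>\<close>), and \<open>\<kappa>\<close> is a bi-Lipschitz bijection when \<open>G\<close> is \<open>C\<^sup>2\<close>-small.
  The function maximized in the definition of \<open>\<phi>(p)\<close> is
  \<open>G(q) + |\<nabla>G(q)|\<^sup>2/2 - |p - q - \<nabla>G(q)|\<^sup>2/4\<close>; its only critical point is \<open>q = \<kappa>\<^sup>-\<^sup>1(p)\<close>, whence
  \<open>\<phi>(\<kappa>(q)) = G(q) - |\<nabla>G(q)|\<^sup>2/2\<close>. This makes the density of \<open>\<parallel>T\<^sub>\<Lambda> v\<parallel>\<^sup>2\<close> at \<open>q\<close> exactly the density
  of \<open>\<parallel>T v\<parallel>\<^sup>2\<close> at \<open>\<kappa>(q)\<close>, so the norms differ only by the distortion of Lebesgue measure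
  under \<open>\<kappa>\<close>, uniformly in \<open>h\<close>.\<close>

section \<open>Lipschitz changes of variables\<close>

text \<open>Since \<open>y = f (g y)\<close>, the preimage lies in the image of the cube under
  \<open>f\<close>. The l1 bound on the diameter puts that image in a cube centred at
  \<open>f u\<close> with half-side \<open>L * DIM('a) * s\<close>. Equal sides make its volume
  comparable to that of the original cube.\<close>

lemma emeasure_vimage_cube_le:
  fixes f g :: "'a::euclidean_space \<Rightarrow> 'a"
  assumes lip: "L-lipschitz_on UNIV f" and fg: "\<And>x. f (g x) = x"
    and s: "s \<ge> 0" "\<And>i. i \<in> Basis \<Longrightarrow> v \<bullet> i - u \<bullet> i = s"
  shows "emeasure lborel (g -` cbox u v)
    \<le> ennreal ((2 * L * DIM('a)) ^ DIM('a)) * emeasure lborel (cbox u v)"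
proof -
  have L: "L \<ge> 0" using lip lipschitz_on_nonneg by blast
  define r where "r = L * DIM('a) * s"
  have r: "r \<ge> 0" using L s by (simp add: r_def)
  have ge: "u \<bullet> i \<le> v \<bullet> i" if "i \<in> Basis" for i
    using s(1) s(2)[OF that] by linarith
  have "dist (f u) y \<le> r" if "g y \<in> cbox u v" for y
  proof -
    have "dist (f u) y = dist (f u) (f (g y))" by (simp add: fg)
    also have "\<dots> \<le> L * dist u (g y)" using lipschitz_onD[OF lip] by simp
    also have "dist u (g y) \<le> (\<Sum>i\<in>Basis. \<bar>(u - g y) \<bullet> i\<bar>)"
      by (simp add: dist_norm norm_le_l1)
    also have "\<dots> \<le> (\<Sum>i::'a\<in>Basis. s)"
    proof (rule sum_mono)
      fix i :: 'a assume i: "i \<in> Basis"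
      then show "\<bar>(u - g y) \<bullet> i\<bar> \<le> s"
        using that s(2)[OF i] by (auto simp: mem_box inner_diff_left)
    qed
    finally show ?thesis using L by (simp add: r_def mult.assoc mult_left_mono)
  qed
  then have "g -` cbox u v \<subseteq> cbox (f u - r *\<^sub>R One) (f u + r *\<^sub>R One)"
  proof (intro subsetI)
    fix y assume "\<And>y. g y \<in> cbox u v \<Longrightarrow> dist (f u) y \<le> r" "y \<in> g -` cbox u v"
    then have "norm (f u - y) \<le> r" by (simp add: dist_norm)
    then have "\<bar>f u \<bullet> i - y \<bullet> i\<bar> \<le> r" if "i \<in> Basis" for i
      using Basis_le_norm[OF that, of "f u - y"] by (simp add: inner_diff_left)
    then have "f u \<bullet> i - r \<le> y \<bullet> i \<and> y \<bullet> i \<le> f u \<bullet> i + r" if "i \<in> Basis" for i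
      using that by (simp add: abs_le_iff) (metis diff_le_eq add.commute)
    then show "y \<in> cbox (f u - r *\<^sub>R One) (f u + r *\<^sub>R One)"
      by (simp add: mem_box inner_diff_left inner_add_left)
  qed
  then have "emeasure lborel (g -` cbox u v) \<le> emeasure lborel (cbox (f u - r *\<^sub>R One) (f u + r *\<^sub>R One))"
    by (rule emeasure_mono) simp
  also have "\<dots> = ennreal (\<Prod>i::'a\<in>Basis. 2 * r)"
    using r by (subst emeasure_lborel_cbox) (auto simp: inner_diff_left inner_add_left intro!: arg_cong[where f=ennreal] prod.cong)
  also have "\<dots> = ennreal ((2 * L * DIM('a)) ^ DIM('a)) * ennreal (\<Prod>i::'a\<in>Basis. s)"
    using L s by (simp add: r_def ennreal_mult[symmetric] power_mult_distrib mult_ac)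
  also have "ennreal (\<Prod>i::'a\<in>Basis. s) = emeasure lborel (cbox u v)"
    using s by (subst emeasure_lborel_cbox) (auto simp: inner_diff_left ge intro!: arg_cong[where f=ennreal] prod.cong)
  finally show ?thesis .
qed

text \<open>The cube estimate is summed over non-overlapping cubes that cover a bounded set inside
  an open neighbourhood; exhaustion by boxes removes the boundedness and outer regularity replaces
  the neighbourhood by \<open>A\<close> itself.\<close>

lemma emeasure_vimage_le_of_Lipschitz:
  fixes f g :: "'a::euclidean_space \<Rightarrow> 'a"
  assumes lip: "L-lipschitz_on UNIV f" and fg: "\<And>x. f (g x) = x"
    and g[measurable]: "g \<in> borel_measurable borel" and A[measurable]: "A \<in> sets borel"
  shows "emeasure lborel (g -` A) \<le> ennreal ((2 * L * DIM('a)) ^ DIM('a)) * emeasure lborel A"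
    (is "_ \<le> ?C * _")
proof -
  have pre[measurable]: "g -` B \<in> sets lborel" if "B \<in> sets borel" for B
    using measurable_sets[OF g that] by simp
  have bounded: "emeasure lborel (g -` B) \<le> ?C * emeasure lborel U"
    if B[measurable]: "B \<in> sets borel" and U: "open U" "B \<subseteq> U"
      and Bn: "B \<subseteq> cbox (- real n *\<^sub>R One) (real n *\<^sub>R One)" and n: "n > 0" for B U and n :: nat
  proof -
    have "\<forall>x\<in>U. \<exists>e>0. ball x e \<subseteq> U" using U(1) open_contains_ball by blast
    then obtain e where e: "\<And>x. x \<in> U \<Longrightarrow> e x > 0" "\<And>x. x \<in> U \<Longrightarrow> ball x (e x) \<subseteq> U" by metis
    \<comment> \<open>Points of \<open>U\<close> get balls inside \<open>U\<close>, so the cubes of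
      the covering, tagged by points of \<open>B\<close>, stay in \<open>U\<close>. The radius 1
      elsewhere only completes the gauge.\<close>
    define \<gamma> where "\<gamma> x = ball x (if x \<in> U then e x else 1)" for x
    have ga: "gauge \<gamma>" unfolding gauge_def \<gamma>_def using e by auto
    have ne: "box (- real n *\<^sub>R One) (real n *\<^sub>R One :: 'a) \<noteq> {}"
      using n by (simp add: box_ne_empty)
    obtain \<D> where D: "countable \<D>" "\<Union>\<D> \<subseteq> cbox (- real n *\<^sub>R One) (real n *\<^sub>R One)"
      "\<And>K. K \<in> \<D> \<Longrightarrow> interior K \<noteq> {} \<and> (\<exists>c d. K = cbox c d)"
      "pairwise (\<lambda>A B. interior A \<inter> interior B = {}) \<D>"
      "\<And>K. K \<in> \<D> \<Longrightarrow> \<exists>x \<in> B \<inter> K. K \<subseteq> \<gamma> x"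
      "\<And>u v. cbox u v \<in> \<D> \<Longrightarrow> \<exists>m. \<forall>i \<in> Basis. v \<bullet> i - u \<bullet> i = (real n *\<^sub>R One \<bullet> i - (- real n *\<^sub>R One) \<bullet> i) / 2^m"
      "B \<subseteq> \<Union>\<D>"
      by (rule covering_lemma[OF Bn ne ga]) blast
    \<comment> \<open>An enumeration of \<D>, finite or not. The default \<open>{}\<close> avoids
      repeating a cube, which would destroy disjointness.\<close>
    define X where "X m = (if m \<in> to_nat_on \<D> ` \<D> then from_nat_into \<D> m else {})" for m
    have X: "X m \<in> \<D> \<or> X m = {}" for m
      using D(1) by (auto simp: X_def)
    have UX: "(\<Union>m. X m) = \<Union>\<D>"
    proof
      show "\<Union>\<D> \<subseteq> (\<Union>m. X m)"
      proof
        fix x assume "x \<in> \<Union>\<D>"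
        then obtain K where K: "K \<in> \<D>" "x \<in> K" by blast
        then have "X (to_nat_on \<D> K) = K" using D(1) by (simp add: X_def)
        then show "x \<in> (\<Union>m. X m)" using K(2) by blast
      qed
      show "(\<Union>m. X m) \<subseteq> \<Union>\<D>" using X by (metis UN_least Union_upper empty_subsetI)
    qed
    have cube: "emeasure lborel (g -` X m) \<le> ?C * emeasure lborel (interior (X m))" for m
    proof (cases "X m = {}")
      case False
      then have m: "X m \<in> \<D>" using X by blast
      then obtain c d where cd: "X m = cbox c d" using D(3) by blast
      obtain k where "\<forall>i \<in> Basis. d \<bullet> i - c \<bullet> i = (real n *\<^sub>R One \<bullet> i - (- real n *\<^sub>R One) \<bullet> i) / 2^k"
        using D(6) m cd by metis
      then have k: "\<And>i. i \<in> Basis \<Longrightarrow> d \<bullet> i - c \<bullet> i = 2 * real n / 2^k" by simp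
      \<comment> \<open>Faces are null sets, so the bound passes to the interiors, which are
        disjoint although the closed cubes may share faces.\<close>
      have "emeasure lborel (cbox c d) = emeasure lborel (box c d)"
        by (simp add: emeasure_lborel_cbox_eq emeasure_lborel_box_eq)
      then show ?thesis
        using emeasure_vimage_cube_le[OF lip fg _ k] by (simp add: cd)
    qed simp
    have Xb: "X m \<in> sets borel" for m using X[of m] D(3)[of "X m"] by (metis borel_closed closed_cbox sets.empty_sets)
    have disj: "disjoint_family (\<lambda>m. interior (X m))"
      unfolding disjoint_family_on_def
    proof (intro ballI impI)
      fix a b :: nat assume ab: "a \<noteq> b"
      show "interior (X a) \<inter> interior (X b) = {}"
      proof (cases "a \<in> to_nat_on \<D> ` \<D> \<and> b \<in> to_nat_on \<D> ` \<D>")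
        case True
        then have "X a \<in> \<D>" "X b \<in> \<D>" "X a \<noteq> X b"
          using ab D(1) by (auto simp: X_def)
        then show ?thesis using D(4) by (auto simp: pairwise_def)
      qed (auto simp: X_def)
    qed
    have sub: "interior (X m) \<subseteq> U" for m
    proof (cases "X m = {}")
      case False
      then obtain x where "x \<in> B" "X m \<subseteq> \<gamma> x" using X D(5) by blast
      then show ?thesis using e(2)[of x] U(2) interior_subset[of "X m"] by (auto simp: \<gamma>_def split: if_splits)
    qed simp
    have "emeasure lborel (g -` B) \<le> emeasure lborel (\<Union>m. g -` X m)"
    proof (rule emeasure_mono)
      have "B \<subseteq> (\<Union>m. X m)" using D(7) UX by simp
      then show "g -` B \<subseteq> (\<Union>m. g -` X m)" by blast
      show "(\<Union>m. g -` X m) \<in> sets lborel"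
        using pre[OF Xb] by (intro sets.countable_UN) blast
    qed
    also have "\<dots> \<le> (\<Sum>m. emeasure lborel (g -` X m))"
      using pre[OF Xb] by (intro emeasure_subadditive_countably) blast
    also have "\<dots> \<le> (\<Sum>m. ?C * emeasure lborel (interior (X m)))"
      by (intro suminf_le cube) auto
    also have "\<dots> = ?C * (\<Sum>m. emeasure lborel (interior (X m)))" by simp
    also have "(\<Sum>m. emeasure lborel (interior (X m))) = emeasure lborel (\<Union>m. interior (X m))"
      by (intro suminf_emeasure disj) auto
    also have "\<dots> \<le> emeasure lborel U"
      using sub U(1) by (intro emeasure_mono) auto
    finally show ?thesis by (simp add: mult_left_mono)
  qed
  have opn: "emeasure lborel (g -` A) \<le> ?C * emeasure lborel U" if U: "open U" "A \<subseteq> U" for U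
  proof -
    \<comment> \<open>\<open>Suc n\<close> keeps every box nondegenerate, as the bounded case
      requires.\<close>
    define W where "W n = box (- real (Suc n) *\<^sub>R One) (real (Suc n) *\<^sub>R One :: 'a)" for n
    have "incseq W" unfolding W_def incseq_def
      by (intro allI impI subset_box_imp) (auto simp: inner_diff_left)
    have "(\<Union>n. W n) = (UNIV :: 'a set)"
    proof -
      have "box (- real n *\<^sub>R One) (real n *\<^sub>R One) \<subseteq> W n" for n
        unfolding W_def by (rule subset_box_imp) auto
      then have "(\<Union>n::nat. box (- real n *\<^sub>R One) (real n *\<^sub>R One)) \<subseteq> (\<Union>n. W n)"
        by (intro UN_mono) auto
      then show ?thesis by (simp add: UN_box_eq_UNIV top.extremum_unique)
    qed
    then have eq: "g -` A = (\<Union>n. g -` (A \<inter> W n))"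
      by (simp flip: vimage_UN Int_UN_distrib)
    have meas: "A \<inter> W n \<in> sets borel" for n
      using A by (simp add: W_def)
    have "range (\<lambda>n. g -` (A \<inter> W n)) \<subseteq> sets lborel"
      using pre[OF meas] by blast
    moreover have "incseq (\<lambda>n. g -` (A \<inter> W n))"
      using \<open>incseq W\<close> unfolding incseq_def by blast
    ultimately have "emeasure lborel (g -` A) = (SUP n. emeasure lborel (g -` (A \<inter> W n)))"
      unfolding eq by (rule SUP_emeasure_incseq[symmetric])
    also have "\<dots> \<le> ?C * emeasure lborel U"
    proof (rule SUP_least)
      fix n
      show "emeasure lborel (g -` (A \<inter> W n)) \<le> ?C * emeasure lborel U"
      proof (rule bounded[where n="Suc n"])
        show "A \<inter> W n \<subseteq> cbox (- real (Suc n) *\<^sub>R One) (real (Suc n) *\<^sub>R One)"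
          unfolding W_def using box_subset_cbox by blast
      qed (use U meas in auto)
    qed
    finally show ?thesis .
  qed
  show ?thesis
  proof (rule ennreal_le_epsilon)
    fix \<epsilon> :: real assume "\<epsilon> > 0"
    \<comment> \<open>The added 1 keeps the denominator positive when the Lipschitz constant is
      0.\<close>
    define \<delta> where "\<delta> = \<epsilon> / ((2 * L * DIM('a)) ^ DIM('a) + 1)"
    have C: "(2 * L * DIM('a)) ^ DIM('a) \<ge> 0" using lipschitz_on_nonneg[OF lip] by simp
    then have d: "\<delta> > 0" "(2 * L * DIM('a)) ^ DIM('a) * \<delta> \<le> \<epsilon>"
      using \<open>\<epsilon> > 0\<close> by (auto simp: \<delta>_def field_simps)
    obtain U where U: "open U" "A \<subseteq> U" "emeasure lborel (U - A) < \<delta>"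
      using outer_regular_lborel[OF A d(1)] by blast
    have "emeasure lborel U = emeasure lborel A + emeasure lborel (U - A)"
      using U(1,2) by (subst plus_emeasure) (auto simp: Un_absorb1)
    then have "emeasure lborel U \<le> emeasure lborel A + ennreal \<delta>"
      using U(3) by (simp add: add_left_mono less_imp_le)
    then have "emeasure lborel (g -` A) \<le> ?C * (emeasure lborel A + ennreal \<delta>)"
      using opn[OF U(1,2)] by (meson mult_left_mono order_trans zero_le)
    also have "\<dots> = ?C * emeasure lborel A + ennreal ((2 * L * DIM('a)) ^ DIM('a) * \<delta>)"
      using C d by (simp add: distrib_left ennreal_mult)
    also have "\<dots> \<le> ?C * emeasure lborel A + ennreal \<epsilon>"
      using d by (intro add_left_mono ennreal_leI)
    finally show "emeasure lborel (g -` A) \<le> ?C * emeasure lborel A + ennreal \<epsilon>" .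
  qed
qed

text \<open>The preimage estimate says that the image of Lebesgue measure under \<open>g\<close> is
  at most a multiple of Lebesgue measure; integrals are monotone in the measure. No Jacobian
  enters.\<close>

lemma nn_integral_comp_le_of_Lipschitz:
  fixes f g :: "'a::euclidean_space \<Rightarrow> 'a"
  assumes lip: "L-lipschitz_on UNIV f" and fg: "\<And>x. f (g x) = x"
    and g[measurable]: "g \<in> borel_measurable borel" and F[measurable]: "F \<in> borel_measurable borel"
  shows "(\<integral>\<^sup>+x. F (g x) \<partial>lborel) \<le> ennreal ((2 * L * DIM('a)) ^ DIM('a)) * (\<integral>\<^sup>+x. F x \<partial>lborel)"
    (is "_ \<le> ?C * _")
proof -
  have "(\<integral>\<^sup>+x. F (g x) \<partial>lborel) = (\<integral>\<^sup>+x. F x \<partial>distr lborel borel g)"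
    by (subst nn_integral_distr) auto
  also have "\<dots> \<le> (\<integral>\<^sup>+x. F x \<partial>scale_measure ?C lborel)"
  proof (rule nn_integral_mono_measure)
    show "distr lborel borel g \<le> scale_measure ?C lborel"
      by (subst le_measure) (auto simp: emeasure_distr intro!: emeasure_vimage_le_of_Lipschitz[OF lip fg])
  qed simp
  also have "\<dots> = ?C * (\<integral>\<^sup>+x. F x \<partial>lborel)"
    by (rule nn_integral_scale_measure) simp
  finally show ?thesis .
qed

section \<open>Small potentials\<close>

text \<open>Phase space is treated as a single Euclidean space; \<open>gradient_Pair\<close> splits
  the result into the x and \<xi> gradients.\<close>

definition gradient :: "('a::euclidean_space \<Rightarrow> real) \<Rightarrow> 'a \<Rightarrow> 'a" where
  "gradient f p = (\<Sum>b\<in>Basis. frechet_derivative f (at p) b *\<^sub>R b)"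

lemma gradient_inner_Basis: "b \<in> Basis \<Longrightarrow> gradient f p \<bullet> b = frechet_derivative f (at p) b"
  by (simp add: gradient_def)

lemma has_derivative_gradient:
  assumes "f differentiable (at p)"
  shows "(f has_derivative (\<lambda>v. gradient f p \<bullet> v)) (at p)"
proof -
  have "frechet_derivative f (at p) v = gradient f p \<bullet> v" for v
  proof -
    interpret bounded_linear "frechet_derivative f (at p)"
      using assms frechet_derivative_works has_derivative_bounded_linear by blast
    have "frechet_derivative f (at p) v = frechet_derivative f (at p) (\<Sum>b\<in>Basis. (v \<bullet> b) *\<^sub>R b)"
      by (simp add: euclidean_representation)
    also have "\<dots> = (\<Sum>b\<in>Basis. (v \<bullet> b) * frechet_derivative f (at p) b)"
      by (simp add: sum scaleR)
    also have "\<dots> = gradient f p \<bullet> v"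
      by (simp add: gradient_def inner_sum_left inner_commute[of v] mult.commute)
    finally show ?thesis .
  qed
  then have "frechet_derivative f (at p) = (\<lambda>v. gradient f p \<bullet> v)" by blast
  then show ?thesis using assms unfolding frechet_derivative_works by simp
qed

text \<open>By induction each iterated derivative agrees with 0 near every point of
  \<open>U\<close>, hence so does the next one.\<close>

lemma iter_deriv_eq_0:
  assumes "open U" "\<And>p. p \<in> U \<Longrightarrow> f p = 0" "p \<in> U"
  shows "iter_deriv bs f p = 0"
  using assms(3)
proof (induction bs arbitrary: p)
  case (Cons b bs)
  have "((\<lambda>_. 0) has_derivative (\<lambda>_. 0)) (at p)" by simp
  then have "(iter_deriv bs f has_derivative (\<lambda>_. 0)) (at p)"
    using assms(1) Cons.prems by (rule has_derivative_transform_within_open) (simp add: Cons.IH)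
  then have "frechet_derivative (iter_deriv bs f) (at p) = (\<lambda>_. 0)"
    by (rule frechet_derivative_at[symmetric])
  then show ?case by simp
qed (use assms in auto)

section \<open>Derivative bounds for compactly supported smooth functions\<close>

context
  fixes G :: "'a::euclidean_space \<Rightarrow> real"
  assumes G: "G \<in> Cc_infinity"
begin

lemma Cc_infinity_differentiable:
  "set bs \<subseteq> Basis \<Longrightarrow> iter_deriv bs G differentiable (at p)"
  using G by (auto simp: Cc_infinity_def differentiable_on_def)

lemma Cc_infinity_vanishing:
  "\<exists>R. \<forall>p bs. norm p > R \<longrightarrow> iter_deriv bs G p = 0"
proof -
  let ?K = "closure {p. G p \<noteq> 0}"
  obtain R where R: "\<And>p. p \<in> ?K \<Longrightarrow> norm p \<le> R"
    using G compact_imp_bounded[of ?K] by (auto simp: Cc_infinity_def bounded_iff)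
  have *: "G p = 0" if "p \<in> - ?K" for p
    using that closure_subset[of "{p. G p \<noteq> 0}"] by blast
  have "iter_deriv bs G p = 0" if "norm p > R" for p bs
  proof (rule iter_deriv_eq_0)
    show "p \<in> - ?K" using R[of p] that by force
    show "open (- ?K)" by (intro open_Compl closed_closure)
  qed (rule *)
  then show ?thesis by blast
qed

lemma Cc_infinity_bounded:
  assumes bs: "set bs \<subseteq> Basis"
  obtains M where "\<And>p. \<bar>iter_deriv bs G p\<bar> \<le> M"
proof -
  obtain R where R: "\<And>p bs. norm p > R \<Longrightarrow> iter_deriv bs G p = 0"
    using Cc_infinity_vanishing by blast
  have "continuous_on (cball 0 R) (iter_deriv bs G)"
    using Cc_infinity_differentiable[OF bs]
    by (simp add: continuous_at_imp_continuous_on differentiable_imp_continuous_within)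
  then have "bounded (iter_deriv bs G ` cball 0 R)"
    by (intro compact_imp_bounded compact_continuous_image) auto
  then obtain M where "\<forall>x\<in>iter_deriv bs G ` cball 0 R. norm x \<le> M"
    unfolding bounded_iff by blast
  then have M: "\<And>p. norm p \<le> R \<Longrightarrow> \<bar>iter_deriv bs G p\<bar> \<le> M" by simp
  have "\<bar>iter_deriv bs G p\<bar> \<le> max M 0" for p
    using M[of p] R[of p bs] by (cases "norm p \<le> R") auto
  then show ?thesis by (rule that)
qed

text \<open>A real supremum dominates its members only if the family is bounded above. Here it is:
  there are finitely many lists of length at most \<open>k\<close>, and each derivative is
  bounded.\<close>

lemma abs_iter_deriv_le_Ck_norm:
  assumes "set bs \<subseteq> Basis" "length bs \<le> k"
  shows "\<bar>iter_deriv bs G p\<bar> \<le> Ck_norm k G"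
proof -
  let ?B = "{bs. set bs \<subseteq> (Basis :: 'a set) \<and> length bs \<le> k}"
  have "\<exists>M. set bs \<subseteq> Basis \<longrightarrow> (\<forall>p. \<bar>iter_deriv bs G p\<bar> \<le> M)" for bs
    by (cases "set bs \<subseteq> Basis") (auto intro: Cc_infinity_bounded)
  then obtain M where M: "\<And>bs p. set bs \<subseteq> Basis \<Longrightarrow> \<bar>iter_deriv bs G p\<bar> \<le> M bs"
    by metis
  have fin: "finite ?B" by (rule finite_lists_length_le) simp
  have "(case x of (bs, p) \<Rightarrow> \<bar>iter_deriv bs G p\<bar>) \<le> Max (M ` ?B)" if x: "x \<in> ?B \<times> UNIV" for x
  proof -
    obtain bs p where bs: "x = (bs, p)" "bs \<in> ?B" using x by blast
    then have "M bs \<le> Max (M ` ?B)" using fin by (intro Max_ge) auto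
    then show ?thesis using M[of bs p] bs by auto
  qed
  then have "bdd_above ((\<lambda>(bs, p). \<bar>iter_deriv bs G p\<bar>) ` (?B \<times> UNIV))"
    by (rule bdd_aboveI2)
  then show ?thesis
    unfolding Ck_norm_def using assms by (intro cSUP_upper2[where x="(bs, p)"]) auto
qed

text \<open>\<open>D\<close> is the Hessian. Its entries are bounded by the \<open>C\<^sup>2\<close>
  norm, and summing over rows and columns costs one factor of the dimension each.\<close>

lemma Cc_infinity_gradient_has_derivative:
  obtains D where "(gradient G has_derivative D) (at p)"
    "\<And>v. norm (D v) \<le> (real DIM('a))\<^sup>2 * Ck_norm 2 G * norm v"
proof -
  let ?d = "\<lambda>b. frechet_derivative (iter_deriv [b] G) (at p)"
  have der: "(iter_deriv [b] G has_derivative ?d b) (at p)" if "b \<in> Basis" for b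
    using Cc_infinity_differentiable[of "[b]" p] that frechet_derivative_works by force
  have bd: "\<bar>?d b v\<bar> \<le> real DIM('a) * Ck_norm 2 G * norm v" if b: "b \<in> Basis" for b v
  proof -
    interpret bounded_linear "?d b" using der[OF b] has_derivative_bounded_linear by blast
    have "?d b v = ?d b (\<Sum>c\<in>Basis. (v \<bullet> c) *\<^sub>R c)"
      by (simp add: euclidean_representation)
    also have "\<dots> = (\<Sum>c\<in>Basis. (v \<bullet> c) * ?d b c)" unfolding sum scaleR by simp
    also have "\<bar>\<dots>\<bar> \<le> (\<Sum>c\<in>Basis. \<bar>(v \<bullet> c) * ?d b c\<bar>)" by (rule sum_abs)
    also have "\<dots> \<le> (\<Sum>c\<in>(Basis::'a set). norm v * Ck_norm 2 G)"
    proof (rule sum_mono)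
      fix c :: 'a assume c: "c \<in> Basis"
      \<comment> \<open>The head of the list is the outermost derivative, so this entry is
        \<open>iter_deriv [c, b] G p\<close>.\<close>
      have "\<bar>?d b c\<bar> \<le> Ck_norm 2 G"
        using abs_iter_deriv_le_Ck_norm[of "[c, b]" 2 p] b c by simp
      then show "\<bar>(v \<bullet> c) * ?d b c\<bar> \<le> norm v * Ck_norm 2 G"
        unfolding abs_mult using Basis_le_norm[OF c] by (intro mult_mono) auto
    qed
    finally show ?thesis by (simp add: mult_ac)
  qed
  have "(gradient G has_derivative (\<lambda>v. \<Sum>b\<in>Basis. ?d b v *\<^sub>R b)) (at p)"
    unfolding gradient_def using der by (auto intro!: derivative_eq_intros)
  moreover have "norm (\<Sum>b\<in>(Basis::'a set). ?d b v *\<^sub>R b) \<le> (real DIM('a))\<^sup>2 * Ck_norm 2 G * norm v" for v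
  proof -
    have "norm (\<Sum>b\<in>(Basis::'a set). ?d b v *\<^sub>R b) \<le> (\<Sum>b\<in>(Basis::'a set). real DIM('a) * Ck_norm 2 G * norm v)"
      using bd by (intro sum_norm_le) auto
    then show ?thesis by (simp add: power2_eq_square mult_ac)
  qed
  ultimately show ?thesis by (rule that)
qed

end

section \<open>The change of variables \<kappa> and the maximum of \<psi>\<close>

text \<open>Here \<open>g\<close> is the gradient of \<open>G\<close>. The bound 1/2 makes it a
  contraction, and the vanishing outside a ball makes \<psi> coercive.\<close>

locale small_potential =
  fixes G :: "'a::euclidean_space \<Rightarrow> real" and g :: "'a \<Rightarrow> 'a" and R :: real
  assumes G_der: "(G has_derivative (\<lambda>v. g p \<bullet> v)) (at p)"
    and g_der: "\<exists>D. (g has_derivative D) (at p) \<and> (\<forall>v. norm (D v) \<le> 1/2 * norm v)"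
    and supp: "norm p > R \<Longrightarrow> G p = 0 \<and> g p = 0"
begin

lemma g_lipschitz: "norm (g p - g q) \<le> 1/2 * norm (p - q)"
proof -
  obtain D where D: "\<And>p. (g has_derivative D p) (at p)" "\<And>p v. norm (D p v) \<le> 1/2 * norm v"
    using g_der by metis
  show ?thesis
    using D by (intro differentiable_bound[of UNIV g D] onorm_le) auto
qed

text \<open>In the complex coordinate \<open>x - i\<xi>\<close>, this is the point \<open>z - i\<zeta>\<close> for \<open>(z, \<zeta>)\<close> the point
  of \<open>\<Lambda>\<close> with parameter \<open>q\<close>.\<close>

definition \<kappa> :: "'a \<Rightarrow> 'a" where "\<kappa> q = q - g q"

definition \<kappa>_inv :: "'a \<Rightarrow> 'a" where "\<kappa>_inv p = (THE q. \<kappa> q = p)"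

text \<open>Solving \<open>\<kappa> q = p\<close> means finding a fixed point of the contraction
  that sends \<open>q\<close> to \<open>p + g q\<close>.\<close>

lemma \<kappa>_bij: "\<exists>!q. \<kappa> q = p"
proof -
  have "\<exists>!q. p + g q = q"
    using g_lipschitz by (intro banach_fix_type[of "1/2"]) (auto simp: dist_norm)
  moreover have "p + g q = q \<longleftrightarrow> \<kappa> q = p" for q
    unfolding \<kappa>_def by (auto simp: algebra_simps)
  ultimately show ?thesis by simp
qed

lemma \<kappa>_\<kappa>_inv: "\<kappa> (\<kappa>_inv p) = p"
  unfolding \<kappa>_inv_def by (rule theI'[OF \<kappa>_bij])

lemma \<kappa>_inv_\<kappa>: "\<kappa>_inv (\<kappa> q) = q"
  using \<kappa>_bij \<kappa>_\<kappa>_inv by metis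

lemma lipschitz_\<kappa>: "2-lipschitz_on UNIV \<kappa>"
proof (rule lipschitz_onI)
  fix p q
  have "dist (\<kappa> p) (\<kappa> q) = norm ((p - q) - (g p - g q))"
    by (simp add: dist_norm \<kappa>_def algebra_simps)
  also have "\<dots> \<le> norm (p - q) + norm (g p - g q)" by (rule norm_triangle_ineq4)
  also have "\<dots> \<le> 2 * dist p q" using g_lipschitz[of p q] norm_ge_zero[of "p - q"] unfolding dist_norm by linarith
  finally show "dist (\<kappa> p) (\<kappa> q) \<le> 2 * dist p q" .
qed simp

text \<open>Subtracting a map with Lipschitz constant 1/2 from the identity shrinks distances by at
  most a factor of 2.\<close>

lemma lipschitz_\<kappa>_inv: "2-lipschitz_on UNIV \<kappa>_inv"
proof (rule lipschitz_onI)
  fix a b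
  let ?p = "\<kappa>_inv a" and ?q = "\<kappa>_inv b"
  have "dist a b = dist (\<kappa> ?p) (\<kappa> ?q)" by (simp add: \<kappa>_\<kappa>_inv)
  also have "\<dots> = norm ((?p - ?q) - (g ?p - g ?q))"
    by (simp add: dist_norm \<kappa>_def algebra_simps)
  finally have "dist a b = norm ((?p - ?q) - (g ?p - g ?q))" .
  moreover have "norm (?p - ?q) - norm (g ?p - g ?q) \<le> norm ((?p - ?q) - (g ?p - g ?q))"
    by (rule norm_triangle_ineq2)
  ultimately show "dist ?p ?q \<le> 2 * dist a b"
    using g_lipschitz[of ?p ?q] by (simp add: dist_norm)
qed simp

text \<open>The function of \<open>q\<close> that is maximized in the definition of \<open>\<phi>(p)\<close>, in real terms.\<close>

definition \<psi> :: "'a \<Rightarrow> 'a \<Rightarrow> real" where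
  "\<psi> p q = G q + (norm (g q))\<^sup>2 / 2 - (norm (p - q - g q))\<^sup>2 / 4"

lemma continuous_g: "continuous_on S g" and continuous_G: "continuous_on S G"
  using G_der g_der by (meson continuous_at_imp_continuous_on has_derivative_continuous)+

lemma \<psi>_attains_max: "\<exists>q. \<forall>q'. \<psi> p q' \<le> \<psi> p q"
proof -
  \<comment> \<open>Outside this ball around \<open>p\<close> both \<open>G\<close> and
    \<open>g\<close> vanish by the first two summands, and the third brings the remaining quadratic
    down to at most \<open>\<psi> p p\<close>.\<close>
  define r where "r = \<bar>R\<bar> + norm p + 2 * sqrt \<bar>\<psi> p p\<bar>"
  have "continuous_on (cball p r) (\<psi> p)"
    unfolding \<psi>_def by (intro continuous_intros continuous_g continuous_G) auto
  moreover have r0: "r \<ge> 0" by (simp add: r_def)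
  ultimately obtain q where q: "\<And>q'. q' \<in> cball p r \<Longrightarrow> \<psi> p q' \<le> \<psi> p q"
    using continuous_attains_sup[of "cball p r" "\<psi> p"] by (metis cball_eq_empty compact_cball not_less)
  have "\<psi> p q' \<le> \<psi> p q" for q'
  proof (cases "q' \<in> cball p r")
    case False
    then have far: "norm (p - q') > r" by (simp add: dist_norm)
    have "norm (p - q') \<le> norm p + norm q'" by (rule norm_triangle_ineq4)
    moreover have "sqrt \<bar>\<psi> p p\<bar> \<ge> 0" by simp
    ultimately have "norm q' > R" using far unfolding r_def by linarith
    then have "\<psi> p q' = - ((norm (p - q'))\<^sup>2 / 4)" using supp by (simp add: \<psi>_def)
    also have "\<dots> \<le> - \<bar>\<psi> p p\<bar>"
    proof -
      have "2 * sqrt \<bar>\<psi> p p\<bar> \<le> norm (p - q')"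
        using far norm_ge_zero[of p] abs_ge_zero[of R] unfolding r_def by linarith
      then have "(2 * sqrt \<bar>\<psi> p p\<bar>)\<^sup>2 \<le> (norm (p - q'))\<^sup>2" by (rule power_mono) simp
      then show ?thesis by (simp add: power_mult_distrib)
    qed
    also have "\<dots> \<le> \<psi> p p" by simp
    also have "\<dots> \<le> \<psi> p q" using r0 by (intro q) simp
    finally show ?thesis .
  qed (rule q)
  then show ?thesis by blast
qed

text \<open>The gradient of \<open>\<psi> p\<close> at \<open>q\<close> is \<open>(1 + G'')(p - q + \<nabla>G(q)) / 2\<close>, and \<open>1 + G''\<close> is invertible.
  So the maximum is located without bounds on third derivatives of \<open>G\<close>.\<close>

lemma \<psi>_critical:
  assumes max: "\<And>q'. \<psi> p q' \<le> \<psi> p q"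
  shows "\<kappa> q = p"
proof -
  obtain D where D: "(g has_derivative D) (at q)" "\<And>v. norm (D v) \<le> 1/2 * norm v"
    using g_der by blast
  define w where "w = p - q + g q"
  have "(\<psi> p has_derivative (\<lambda>v. w \<bullet> (v + D v) / 2)) (at q)"
    unfolding \<psi>_def power2_norm_eq_inner w_def
    by (rule derivative_eq_intros G_der D refl | simp)+
      (auto simp: fun_eq_iff inner_diff_left inner_diff_right inner_add_left inner_add_right inner_commute field_simps)
  then have "(\<lambda>v. w \<bullet> (v + D v) / 2) = (\<lambda>v. 0)"
    by (rule differential_zero_maxmin[of q UNIV, rotated 2]) (use max in auto)
  \<comment> \<open>Testing the vanishing derivative in the direction \<open>w\<close> itself lets
    the norm bound on \<open>D\<close> force \<open>w = 0\<close>.\<close>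
  then have "w \<bullet> (w + D w) = 0" by (metis divide_eq_0_iff zero_neq_numeral)
  then have "(norm w)\<^sup>2 = - (w \<bullet> D w)" by (simp add: inner_add_right power2_norm_eq_inner)
  also have "\<dots> \<le> norm w * norm (D w)" using Cauchy_Schwarz_ineq2[of w "D w"] by linarith
  also have "\<dots> \<le> norm w * (1/2 * norm w)" by (intro mult_left_mono D) simp
  finally have "w = 0" by (simp add: power2_eq_square mult_le_0_iff)
  then show ?thesis by (simp add: w_def \<kappa>_def algebra_simps)
qed

text \<open>A maximizer exists and every maximizer solves \<open>\<kappa> q = p\<close>, so it is
  \<open>\<kappa>_inv p\<close>. There \<open>p - q = - g q\<close>, which gives the value.\<close>

lemma \<psi>_le: "\<psi> p q \<le> G (\<kappa>_inv p) - (norm (g (\<kappa>_inv p)))\<^sup>2 / 2"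
  and \<psi>_\<kappa>_inv: "\<psi> p (\<kappa>_inv p) = G (\<kappa>_inv p) - (norm (g (\<kappa>_inv p)))\<^sup>2 / 2"
proof -
  obtain q0 where q0: "\<And>q'. \<psi> p q' \<le> \<psi> p q0" using \<psi>_attains_max by blast
  then have k: "\<kappa>_inv p = q0" using \<psi>_critical \<kappa>_inv_\<kappa> by blast
  have "p - \<kappa>_inv p - g (\<kappa>_inv p) = - 2 *\<^sub>R g (\<kappa>_inv p)"
    using \<kappa>_\<kappa>_inv[of p] by (simp add: \<kappa>_def algebra_simps scaleR_2)
  then show *: "\<psi> p (\<kappa>_inv p) = G (\<kappa>_inv p) - (norm (g (\<kappa>_inv p)))\<^sup>2 / 2"
    by (simp add: \<psi>_def power_mult_distrib)
  show "\<psi> p q \<le> G (\<kappa>_inv p) - (norm (g (\<kappa>_inv p)))\<^sup>2 / 2"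
    using q0[of q] * unfolding k by simp
qed

end

text \<open>The threshold is the one at which the Hessian bound becomes 1/2.\<close>

lemma small_potentialI:
  fixes G :: "'a::euclidean_space \<Rightarrow> real"
  assumes "G \<in> Cc_infinity" "Ck_norm 2 G < 1 / (2 * (real DIM('a))\<^sup>2)"
  shows "\<exists>R. small_potential G (gradient G) R"
proof -
  obtain R where R: "\<And>p bs. norm p > R \<Longrightarrow> iter_deriv bs G p = 0"
    using Cc_infinity_vanishing[OF assms(1)] by blast
  have *: "(real DIM('a))\<^sup>2 * Ck_norm 2 G \<le> 1 / 2"
    using assms(2) by (simp add: field_simps)
  have "small_potential G (gradient G) R"
  proof
    fix p
    show "(G has_derivative (\<lambda>v. gradient G p \<bullet> v)) (at p)"
      using Cc_infinity_differentiable[OF assms(1), of "[]" p] by (simp add: has_derivative_gradient)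
    show "\<exists>D. (gradient G has_derivative D) (at p) \<and> (\<forall>v. norm (D v) \<le> 1 / 2 * norm v)"
    proof -
      obtain D where D: "(gradient G has_derivative D) (at p)"
        "\<And>v. norm (D v) \<le> (real DIM('a))\<^sup>2 * Ck_norm 2 G * norm v"
        using Cc_infinity_gradient_has_derivative[OF assms(1), of p] by blast
      have "norm (D v) \<le> 1 / 2 * norm v" for v
        using D(2)[of v] mult_right_mono[OF * norm_ge_zero[of v]] by linarith
      then show ?thesis using D(1) by blast
    qed
    assume p: "norm p > R"
    then show "G p = 0 \<and> gradient G p = 0"
      using R[of p "[]"] R[of p "[_]"] by (simp add: gradient_def)
  qed
  then show ?thesis by blast
qed

section \<open>Phases and the FBI transform\<close>

lemma cdot_minus_sum_squares:
  "cdot (y - w) (y - w) + cdot (y - w') (y - w') =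
    2 * cdot (y - (1/2) *s (w + w')) (y - (1/2) *s (w + w')) + cdot (w - w') (w - w') / 2"
  unfolding cdot_def sum_distrib_left sum_divide_distrib sum.distrib[symmetric]
  by (intro sum.cong) (auto simp: field_simps)

lemma cdot_minus_commute: "cdot (a - b) (a - b) = cdot (b - a) (b - a)"
  by (simp add: cdot_def algebra_simps)

text \<open>Completing the square leaves \<open>y\<close> coupled to \<open>z\<close> and \<zeta>
  only through the combination \<open>z - \<i> *s \<zeta>\<close>.\<close>

lemma \<Phi>_complete_square:
  "\<Phi> z \<zeta> y = \<i> / 2 * (cdot (z - \<i> *s \<zeta> - y) (z - \<i> *s \<zeta> - y) + cdot \<zeta> \<zeta>)"
  unfolding \<Phi>_def cdot_def sum_distrib_left sum.distrib[symmetric]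
  by (intro sum.cong) (auto simp: field_simps)

lemma \<Phi>_bar_complete_square:
  "\<Phi>_bar z \<zeta> y = - \<i> / 2 * (cdot (z + \<i> *s \<zeta> - y) (z + \<i> *s \<zeta> - y) + cdot \<zeta> \<zeta>)"
  unfolding \<Phi>_bar_def cdot_def sum_distrib_left sum.distrib[symmetric] sum_subtractf[symmetric]
  by (intro sum.cong) (auto simp: field_simps)

lemma Re_cdot_self:
  "Re (cdot (cvec a + \<i> *s cvec b) (cvec a + \<i> *s cvec b)) = (norm a)\<^sup>2 - (norm b)\<^sup>2"
  by (simp add: cdot_def cvec_def power2_norm_eq_inner inner_vec_def sum_subtractf[symmetric])

lemma cdot_has_derivative:
  "((\<lambda>y. cdot (y - m) (y - m)) has_derivative (\<lambda>d. 2 * cdot (y - m) d)) (at y)"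
proof -
  have "((\<lambda>y. (y $ i - m $ i) * (y $ i - m $ i)) has_derivative (\<lambda>d. 2 * ((y $ i - m $ i) * d $ i))) (at y)"
    for i
    by (rule derivative_eq_intros bounded_linear.has_derivative[OF bounded_linear_vec_nth] refl)+
      (simp add: fun_eq_iff algebra_simps)
  then show ?thesis
    unfolding cdot_def sum_distrib_left vector_minus_component by (intro has_derivative_sum) simp
qed

text \<open>The bilinear form is nondegenerate, as testing on coordinate vectors shows, so
  \<open>m\<close> is the only critical point and the definite description is well defined.\<close>

lemma critical_value_quadratic:
  fixes m :: "complex^'n"
  assumes "a \<noteq> 0"
  shows "critical_value (\<lambda>y. a * cdot (y - m) (y - m) + c) = c"
proof -
  let ?f = "\<lambda>y. a * cdot (y - m) (y - m) + c"
  have der: "(?f has_derivative (\<lambda>d. a * (2 * cdot (y - m) d))) (at y)" for y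
    by (intro has_derivative_add_const has_derivative_mult_right cdot_has_derivative)
  have crit: "y = m" if "(?f has_derivative (\<lambda>_. 0)) (at y)" for y
  proof -
    have "(\<lambda>d. a * (2 * cdot (y - m) d)) = (\<lambda>_. 0)"
      using has_derivative_unique[OF der that] .
    then have "cdot (y - m) (axis i 1) = 0" for i
      using assms by (metis mult_eq_0_iff zero_neq_numeral)
    then have "(y - m) $ i = 0" for i
      by (simp add: cdot_def axis_def if_distrib sum.delta cong: if_cong)
    then show ?thesis by (simp add: vec_eq_iff)
  qed
  show ?thesis unfolding critical_value_def
  proof (rule the_equality)
    show "\<exists>y. (?f has_derivative (\<lambda>_. 0)) (at y) \<and> c = ?f y"
      using der[of m] by (intro exI[of _ m]) (simp add: cdot_def)
    show "w = c" if w: "\<exists>y. (?f has_derivative (\<lambda>_. 0)) (at y) \<and> w = ?f y" for w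
    proof -
      obtain y where y: "(?f has_derivative (\<lambda>_. 0)) (at y)" "w = ?f y" using w by blast
      then show ?thesis using crit[OF y(1)] by (simp add: cdot_def)
    qed
  qed
qed

lemma critical_value_phase:
  "critical_value (\<lambda>y. \<Phi> a b y - \<Phi>_bar z \<zeta> y) =
    \<i> / 2 * (cdot (a - \<i> *s b - (z + \<i> *s \<zeta>)) (a - \<i> *s b - (z + \<i> *s \<zeta>)) / 2
      + cdot b b + cdot \<zeta> \<zeta>)"
proof -
  define w w' where "w = a - \<i> *s b" and "w' = z + \<i> *s \<zeta>"
  define m where "m = (1/2) *s (w + w')"
  have "\<Phi> a b y - \<Phi>_bar z \<zeta> y =
      \<i> / 2 * (cdot (y - w) (y - w) + cdot (y - w') (y - w') + cdot b b + cdot \<zeta> \<zeta>)" for y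
    unfolding \<Phi>_complete_square \<Phi>_bar_complete_square w_def[symmetric] w'_def[symmetric]
      cdot_minus_commute[of w y] cdot_minus_commute[of w' y]
    by (simp add: algebra_simps)
  \<comment> \<open>The two squares in \<open>y\<close> add up because the phases carry opposite
    signs; recentring at the midpoint \<open>m\<close> exhibits the critical point.\<close>
  also have "\<dots> y = \<i> * cdot (y - m) (y - m)
      + \<i> / 2 * (cdot (w - w') (w - w') / 2 + cdot b b + cdot \<zeta> \<zeta>)" for y
    unfolding cdot_minus_sum_squares m_def by (simp add: field_simps)
  finally show ?thesis
    by (simp add: critical_value_quadratic flip: w_def w'_def)
qed

lemma gradient_Pair: "gradient G p = (grad_x G p, grad_\<xi> G p)"
proof (rule euclidean_eqI)
  fix b :: "(real^'a) \<times> (real^'a)" assume b: "b \<in> Basis"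
  then consider i where "b = (axis i 1, 0)" | i where "b = (0, axis i 1)"
    by (auto simp: Basis_prod_def Basis_vec_def)
  then show "gradient G p \<bullet> b = (grad_x G p, grad_\<xi> G p) \<bullet> b"
    using gradient_inner_Basis[OF b, of G p]
    by cases (simp_all add: grad_x_def grad_\<xi>_def inner_axis)
qed

lemma phase_value:
  "- Im (critical_value (\<lambda>y. \<Phi> (cvec x) (cvec \<xi>) y - \<Phi>_bar (Lambda_z G q) (Lambda_\<zeta> G q) y))
     + H_weight G q =
   G q + (norm (gradient G q))\<^sup>2 / 2 - (norm ((x, \<xi>) - q - gradient G q))\<^sup>2 / 4"
proof -
  obtain x' \<xi>' where q: "q = (x', \<xi>')" by (cases q)
  define a b where "a = grad_x G q" and "b = grad_\<xi> G q"
  \<comment> \<open>The second component of the critical value contains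
    \<open>\<xi> + \<xi>' + b\<close>, that of \<psi> contains \<open>\<xi> - \<xi>' - b\<close>.
    The parallelogram law, with the squares of \<xi> and \<open>\<xi>'\<close> and the term
    \<open>\<xi>' \<bullet> b\<close> of the weight, converts one into the other.\<close>
  define c where "c = - (\<xi> + \<xi>' + b)"
  have c: "norm c = norm (\<xi> + \<xi>' + b)" unfolding c_def by (rule norm_minus_cancel)
  have w: "cvec x - \<i> *s cvec \<xi> - (Lambda_z G q + \<i> *s Lambda_\<zeta> G q)
      = cvec (x - x' - a) + \<i> *s cvec c"
    by (simp add: vec_eq_iff Lambda_z_def Lambda_\<zeta>_def cvec_def a_def b_def c_def q algebra_simps)
  have \<xi>: "cvec \<xi> = cvec \<xi> + \<i> *s cvec 0"
    by (simp add: vec_eq_iff cvec_def)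
  have \<zeta>: "Lambda_\<zeta> G q = cvec \<xi>' + \<i> *s cvec (- a)"
    by (simp add: vec_eq_iff Lambda_\<zeta>_def cvec_def a_def q)
  have \<xi>2: "Re (cdot (cvec \<xi>) (cvec \<xi>)) = (norm \<xi>)\<^sup>2"
    by (subst (1 2) \<xi>, subst Re_cdot_self) simp
  have cv: "- Im (critical_value (\<lambda>y. \<Phi> (cvec x) (cvec \<xi>) y - \<Phi>_bar (Lambda_z G q) (Lambda_\<zeta> G q) y)) =
      - (((norm (x - x' - a))\<^sup>2 - (norm (\<xi> + \<xi>' + b))\<^sup>2) / 2 + (norm \<xi>)\<^sup>2 + ((norm \<xi>')\<^sup>2 - (norm a)\<^sup>2)) / 2"
    unfolding critical_value_phase w unfolding \<zeta>
    by (simp add: Re_cdot_self \<xi>2 c) (simp add: field_simps)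
  have gr: "gradient G q = (a, b)" by (simp add: gradient_Pair a_def b_def)
  have H: "H_weight G q = G q - \<xi>' \<bullet> b" by (simp add: H_weight_def b_def q)
  have diff: "(x, \<xi>) - q - (a, b) = (x - x' - a, \<xi> - \<xi>' - b)" by (simp add: q)
  have norm2: "(norm (u, v))\<^sup>2 = u \<bullet> u + v \<bullet> v" for u v :: "real^'a"
    by (simp add: norm_Pair power2_norm_eq_inner)
  show ?thesis
    unfolding cv gr H diff norm2 power2_norm_eq_inner
    by (simp add: inner_diff_left inner_diff_right inner_add_left inner_add_right
        inner_commute field_simps)
qed

section \<open>The FBI transform as a Gaussian integral\<close>

definition cpoint :: "(real^'n) \<times> (real^'n) \<Rightarrow> complex^'n" where
  "cpoint p = cvec (fst p) - \<i> *s cvec (snd p)"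

text \<open>Up to normalization and an exponential weight this is the Bargmann transform of
  \<open>u\<close>.\<close>

definition Bargmann :: "real \<Rightarrow> (real^'n \<Rightarrow> complex) \<Rightarrow> complex^'n \<Rightarrow> complex" where
  "Bargmann h u w = (LINT y|lebesgue. exp (- cdot (w - cvec y) (w - cvec y) / of_real (2 * h)) * u y)"

text \<open>The type argument carries the dimension, which the type of the value does not
  determine.\<close>

definition FBI_const :: "real \<Rightarrow> 'n itself \<Rightarrow> real" where
  "FBI_const h _ = 2 powr (- real CARD('n) / 2) * pi powr (- 3 * real CARD('n) / 4)
              * h powr (- 3 * real CARD('n) / 4)"

lemma FBI_eq_Bargmann:
  fixes u :: "real^'n \<Rightarrow> complex"
  assumes "h > 0"
  shows "FBI h u z \<zeta> = of_real (FBI_const h TYPE('n)) * exp (- cdot \<zeta> \<zeta> / of_real (2 * h))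
    * Bargmann h u (z - \<i> *s \<zeta>)"
proof -
  have "\<i> / of_real h * \<Phi> z \<zeta> y = - cdot \<zeta> \<zeta> / of_real (2 * h)
      + - cdot (z - \<i> *s \<zeta> - y) (z - \<i> *s \<zeta> - y) / of_real (2 * h)" for y
    unfolding \<Phi>_complete_square using assms by (simp add: field_simps)
  then show ?thesis
    unfolding FBI_def Bargmann_def FBI_const_def by (simp only: exp_add mult.assoc integral_mult_right_zero)
qed

lemma cmod_FBI_sq:
  fixes u :: "real^'n \<Rightarrow> complex"
  assumes "h > 0"
  shows "(cmod (FBI h u z \<zeta>))\<^sup>2 = (FBI_const h TYPE('n))\<^sup>2 * exp (- Re (cdot \<zeta> \<zeta>) / h)
    * (cmod (Bargmann h u (z - \<i> *s \<zeta>)))\<^sup>2"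
proof -
  have "(exp (- Re (cdot \<zeta> \<zeta>) / (2 * h)))\<^sup>2 = exp (- Re (cdot \<zeta> \<zeta>) / h)"
    using assms by (simp add: exp_double[symmetric])
  moreover have "Re (- cdot \<zeta> \<zeta> / complex_of_real (2 * h)) = - Re (cdot \<zeta> \<zeta>) / (2 * h)"
    by (simp only: Re_divide_of_real uminus_complex.sel)
  ultimately show ?thesis
    by (simp only: FBI_eq_Bargmann[OF assms] norm_mult norm_exp_eq_Re norm_of_real power_mult_distrib power2_abs)
qed

lemma cvec_nth [simp]: "cvec x $ i = of_real (x $ i)"
  by (simp add: cvec_def)

lemma sigma_finite_lebesgue: "sigma_finite_measure (lebesgue :: 'a::euclidean_space measure)"
proof
  obtain A :: "'a set set" where "countable A" "A \<subseteq> sets lborel" "\<Union>A = space lborel"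
    "\<forall>a\<in>A. emeasure lborel a \<noteq> \<infinity>"
    using lborel.sigma_finite_countable by blast
  then show "\<exists>A::'a set set. countable A \<and> A \<subseteq> sets lebesgue \<and> \<Union> A = space lebesgue
      \<and> (\<forall>a\<in>A. emeasure lebesgue a \<noteq> \<infinity>)"
    by (intro exI[of _ A]) auto
qed

text \<open>The kernel is jointly continuous and \<open>u\<close> is Lebesgue measurable in
  \<open>y\<close>, so the integrand is jointly measurable and its integral over the sigma-finite
  factor is Borel in the parameter.\<close>

lemma borel_measurable_Bargmann:
  fixes u :: "real^'n \<Rightarrow> complex"
  assumes "u \<in> borel_measurable lebesgue"
  shows "(\<lambda>p. Bargmann h u (cpoint p)) \<in> borel_measurable borel"
proof -
  define k :: "((real^'n) \<times> (real^'n)) \<times> (real^'n) \<Rightarrow> complex" where "k = (\<lambda>(p, y). exp (- cdot (cpoint p - cvec y) (cpoint p - cvec y) / of_real (2 * h)))"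
  have "continuous_on UNIV k"
    unfolding k_def split_beta cdot_def cpoint_def divide_inverse
      vector_minus_component vector_smult_component cvec_nth
    by (intro continuous_intros)
  then have "k \<in> borel_measurable (borel \<Otimes>\<^sub>M borel)"
    unfolding borel_prod by (rule borel_measurable_continuous_onI)
  moreover
  have "(\<lambda>y. y) \<in> lebesgue \<rightarrow>\<^sub>M (borel :: (real^'n) measure)"
    by (intro measurable_completion) simp
  then have "(\<lambda>x. (fst x, snd x)) \<in> borel \<Otimes>\<^sub>M lebesgue \<rightarrow>\<^sub>M
      (borel :: ((real^'n) \<times> (real^'n)) measure) \<Otimes>\<^sub>M (borel :: (real^'n) measure)"
    by (intro measurable_Pair measurable_fst measurable_compose[OF measurable_snd])
  ultimately have "(\<lambda>x. k (fst x, snd x)) \<in> borel_measurable (borel \<Otimes>\<^sub>M lebesgue)"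
    by (rule measurable_compose[rotated])
  then have k: "k \<in> borel_measurable (borel \<Otimes>\<^sub>M lebesgue)" by simp
  have "(\<lambda>z. k z * u (snd z)) \<in> borel_measurable (borel \<Otimes>\<^sub>M lebesgue)"
    using k measurable_compose[OF measurable_snd assms] by (rule borel_measurable_times)
  then show ?thesis
    unfolding Bargmann_def
    by (intro sigma_finite_measure.borel_measurable_lebesgue_integral[OF sigma_finite_lebesgue])
      (simp add: k_def split_beta)
qed

section \<open>Comparison of the norms\<close>

text \<open>Taking square roots turns \<open>C\<^sup>2\<close> into \<open>C\<close>. An infinite
  right-hand integral is treated apart, since the norm is given by a real square root
  otherwise.\<close>

lemma weighted_L2_norm_le:
  assumes C: "C > 0"
    and le: "(\<integral>\<^sup>+p. ennreal ((cmod (f p))\<^sup>2 * exp (- 2 * w p / h)) \<partial>lebesgue)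
      \<le> ennreal (C\<^sup>2) * (\<integral>\<^sup>+p. ennreal ((cmod (f' p))\<^sup>2 * exp (- 2 * w' p / h)) \<partial>lebesgue)"
      (is "?I \<le> _ * ?J")
  shows "weighted_L2_norm h w f \<le> ennreal C * weighted_L2_norm h w' f'"
proof (cases "?J = \<infinity>")
  case True
  then show ?thesis using C by (simp add: weighted_L2_norm_def ennreal_mult_top)
next
  case False
  then obtain j where j: "j \<ge> 0" "?J = ennreal j" by (cases ?J) auto
  then have le': "?I \<le> ennreal (C\<^sup>2 * j)" using le by (simp add: ennreal_mult)
  then obtain i where i: "i \<ge> 0" "?I = ennreal i" by (cases ?I) (auto simp: top_unique)
  have "i \<le> C\<^sup>2 * j" using le' i j by simp
  then have "sqrt i \<le> C * sqrt j"
    using C real_sqrt_le_mono[of i "C\<^sup>2 * j"] by (simp add: real_sqrt_mult)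
  then show ?thesis
    using C i j by (simp add: weighted_L2_norm_def Let_def ennreal_mult[symmetric])
qed

lemma \<phi>_weight_eq:
  assumes "small_potential G (gradient G) R"
  shows "\<phi>_weight G (small_potential.\<kappa> (gradient G) q) = G q - (norm (gradient G q))\<^sup>2 / 2"
proof -
  interpret small_potential G "gradient G" R by fact
  have "\<phi>_weight G p = G (\<kappa>_inv p) - (norm (gradient G (\<kappa>_inv p)))\<^sup>2 / 2" for p
  proof -
    obtain x \<xi> where p: "p = (x, \<xi>)" by (cases p)
    have "\<phi>_weight G p = (GREATEST m. m \<in> range (\<psi> p))"
      unfolding \<phi>_weight_def p case_prod_conv phase_value \<psi>_def ..
    also have "\<dots> = G (\<kappa>_inv p) - (norm (gradient G (\<kappa>_inv p)))\<^sup>2 / 2"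
    proof (rule Greatest_equality)
      show "G (\<kappa>_inv p) - (norm (gradient G (\<kappa>_inv p)))\<^sup>2 / 2 \<in> range (\<psi> p)"
        using \<psi>_\<kappa>_inv by (metis rangeI)
      show "m \<le> G (\<kappa>_inv p) - (norm (gradient G (\<kappa>_inv p)))\<^sup>2 / 2" if "m \<in> range (\<psi> p)" for m
        using that \<psi>_le[of p] by blast
    qed
    finally show ?thesis .
  qed
  then show ?thesis by (simp add: \<kappa>_inv_\<kappa>)
qed

text \<open>On \<Lambda> the Gaussian integral is evaluated at the point \<kappa>(q), so only the
  exponential weights have to be matched. Measurability holds since \<phi> is continuous, being a
  continuous function composed with \<open>\<kappa>_inv\<close>.\<close>

lemma weighted_densities:
  fixes v :: "real^'n \<Rightarrow> complex"
  assumes G: "small_potential G (gradient G) R" and h: "h > 0"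
  defines "F \<equiv> \<lambda>p. (cmod (FBI_real h v p))\<^sup>2 * exp (- 2 * \<phi>_weight G p / h)"
  shows "(cmod (T_Lambda G h v q))\<^sup>2 * exp (- 2 * H_weight G q / h) = F (small_potential.\<kappa> (gradient G) q)"
    and "v \<in> borel_measurable lebesgue \<Longrightarrow> F \<in> borel_measurable borel"
proof -
  interpret small_potential G "gradient G" R by fact
  define c where "c = (FBI_const h TYPE('n))\<^sup>2"
  have F: "F p = c * exp (- (norm (snd p))\<^sup>2 / h) * (cmod (Bargmann h v (cpoint p)))\<^sup>2
      * exp (- 2 * \<phi>_weight G p / h)" for p
  proof -
    have "cvec (snd p) = cvec (snd p) + \<i> *s cvec 0" by (simp add: vec_eq_iff)
    then have "Re (cdot (cvec (snd p)) (cvec (snd p))) = (norm (snd p))\<^sup>2"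
      by (metis Re_cdot_self diff_zero norm_zero power_zero_numeral)
    then show ?thesis
      by (simp add: F_def FBI_real_def split_beta cmod_FBI_sq[OF h] c_def cpoint_def)
  qed
  define a b where "a = grad_x G q" and "b = grad_\<xi> G q"
  have gr: "gradient G q = (a, b)" by (simp add: gradient_Pair a_def b_def)
  have w: "Lambda_z G q - \<i> *s Lambda_\<zeta> G q = cpoint (\<kappa> q)"
    by (simp add: vec_eq_iff Lambda_z_def Lambda_\<zeta>_def cpoint_def \<kappa>_def gr algebra_simps
        flip: a_def b_def)
  have "Lambda_\<zeta> G q = cvec (snd q) + \<i> *s cvec (- a)"
    by (simp add: vec_eq_iff Lambda_\<zeta>_def flip: a_def)
  then have \<zeta>: "Re (cdot (Lambda_\<zeta> G q) (Lambda_\<zeta> G q)) = (norm (snd q))\<^sup>2 - (norm a)\<^sup>2"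
    by (simp only: Re_cdot_self norm_minus_cancel)
  have snd: "snd (\<kappa> q) = snd q - b" by (simp add: \<kappa>_def gr)
  have norm_g: "(norm (gradient G q))\<^sup>2 = a \<bullet> a + b \<bullet> b"
    by (simp add: gr norm_Pair power2_norm_eq_inner)
  \<comment> \<open>The exact cancellation: the cross term of the expanded square is supplied by the
    \<xi>-gradient term of the weight \<open>H_weight\<close>.\<close>
  have "- ((norm (snd q))\<^sup>2 - (norm a)\<^sup>2) + - 2 * H_weight G q
      = - (norm (snd q - b))\<^sup>2 + - 2 * (G q - (a \<bullet> a + b \<bullet> b) / 2)"
    by (simp add: H_weight_def power2_norm_eq_inner inner_diff_left inner_diff_right inner_commute
        field_simps flip: b_def)
  then have "exp (- ((norm (snd q))\<^sup>2 - (norm a)\<^sup>2) / h) * exp (- 2 * H_weight G q / h)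
      = exp (- (norm (snd q - b))\<^sup>2 / h) * exp (- 2 * (G q - (a \<bullet> a + b \<bullet> b) / 2) / h)"
    unfolding exp_add[symmetric] add_divide_distrib[symmetric] by simp
  then show "(cmod (T_Lambda G h v q))\<^sup>2 * exp (- 2 * H_weight G q / h) = F (\<kappa> q)"
    unfolding F T_Lambda_def cmod_FBI_sq[OF h] w \<zeta> \<phi>_weight_eq[OF G] norm_g snd c_def
    by (simp add: mult_ac)
  assume v: "v \<in> borel_measurable lebesgue"
  have "continuous_on UNIV (\<lambda>p. G (\<kappa>_inv p) - (norm (gradient G (\<kappa>_inv p)))\<^sup>2 / 2)"
    using lipschitz_on_continuous_on[OF lipschitz_\<kappa>_inv]
    by (intro continuous_intros continuous_on_compose2[OF continuous_G[of UNIV]]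
        continuous_on_compose2[OF continuous_g[of UNIV]]) auto
  moreover have "\<phi>_weight G p = G (\<kappa>_inv p) - (norm (gradient G (\<kappa>_inv p)))\<^sup>2 / 2" for p
    using \<phi>_weight_eq[OF G, of "\<kappa>_inv p"] by (simp add: \<kappa>_\<kappa>_inv)
  ultimately have [measurable]: "\<phi>_weight G \<in> borel_measurable borel"
    by (metis (no_types, lifting) borel_measurable_continuous_onI ext)
  have [measurable]: "(\<lambda>p. Bargmann h v (cpoint p)) \<in> borel_measurable borel"
    using v by (rule borel_measurable_Bargmann)
  have [measurable]: "(\<lambda>p :: (real^'n) \<times> (real^'n). norm (snd p)) \<in> borel_measurable borel"
    by (intro borel_measurable_continuous_onI continuous_intros)
  show "F \<in> borel_measurable borel"
    unfolding F by measurable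
qed

theorem theorem4:
  shows "\<exists>\<epsilon>\<^sub>0>0. \<exists>C\<^sub>0>0. \<forall>G :: (real^'n) \<times> (real^'n) \<Rightarrow> real.
    G \<in> Cc_infinity \<and> Ck_norm 2 G < \<epsilon>\<^sub>0 \<longrightarrow>
    (\<forall>h>0. \<forall>v\<in>L2.
       ennreal (1 / C\<^sub>0) * weighted_L2_norm h (H_weight G) (T_Lambda G h v)
         \<le> weighted_L2_norm h (\<phi>_weight G) (FBI_real h v) \<and>
       weighted_L2_norm h (\<phi>_weight G) (FBI_real h v)
         \<le> ennreal C\<^sub>0 * weighted_L2_norm h (H_weight G) (T_Lambda G h v))"
proof -
  define N where "N = DIM((real^'n) \<times> (real^'n))"
  have N: "N > 0" unfolding N_def by (rule DIM_positive)
  \<comment> \<open>\<open>C\<^sup>2\<close> is the factor of the change of variables with Lipschitz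
    constant 2, valid for both \<kappa> and its inverse. It depends only on the dimension
    \<open>N\<close> of phase space, not on \<open>h\<close>.\<close>
  define C where "C = sqrt ((2 * 2 * real N) ^ N)"
  have C: "C > 0" "C\<^sup>2 = (2 * 2 * real N) ^ N" using N by (simp_all add: C_def)
  show ?thesis
  proof (intro exI conjI allI impI ballI)
    show "1 / (2 * (real N)\<^sup>2) > 0" using N by simp
    show "C > 0" by fact
  next
    fix G :: "(real^'n) \<times> (real^'n) \<Rightarrow> real" and h :: real and v :: "real^'n \<Rightarrow> complex"
    assume G: "G \<in> Cc_infinity \<and> Ck_norm 2 G < 1 / (2 * (real N)\<^sup>2)" and h: "h > 0" and "v \<in> L2"
    then have v: "v \<in> borel_measurable lebesgue" by (simp add: L2_def)
    obtain R where R: "small_potential G (gradient G) R"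
      using small_potentialI[of G] G unfolding N_def by blast
    interpret small_potential G "gradient G" R by fact
    define F where "F = (\<lambda>p. (cmod (FBI_real h v p))\<^sup>2 * exp (- 2 * \<phi>_weight G p / h))"
    note dens = weighted_densities[OF R h, where v=v, folded F_def]
    have [measurable]: "F \<in> borel_measurable borel" using dens(2) v by blast
    have [measurable]: "\<kappa> \<in> borel_measurable borel" "\<kappa>_inv \<in> borel_measurable borel"
      using lipschitz_\<kappa> lipschitz_\<kappa>_inv
      by (auto intro: borel_measurable_continuous_onI lipschitz_on_continuous_on)
    \<comment> \<open>The densities are Borel, so integrals over the completed measure may be
      computed with \<open>lborel\<close>.\<close>
    have T: "(\<integral>\<^sup>+p. ennreal ((cmod (T_Lambda G h v p))\<^sup>2 * exp (- 2 * H_weight G p / h)) \<partial>lebesgue)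
        = (\<integral>\<^sup>+p. ennreal (F (\<kappa> p)) \<partial>lborel)"
      unfolding dens(1) F_def by (rule nn_integral_completion)
    have S: "(\<integral>\<^sup>+p. ennreal ((cmod (FBI_real h v p))\<^sup>2 * exp (- 2 * \<phi>_weight G p / h)) \<partial>lebesgue)
        = (\<integral>\<^sup>+p. ennreal (F p) \<partial>lborel)"
      unfolding F_def by (rule nn_integral_completion)
    have "(\<integral>\<^sup>+p. ennreal (F (\<kappa> p)) \<partial>lborel) \<le> ennreal (C\<^sup>2) * (\<integral>\<^sup>+p. ennreal (F p) \<partial>lborel)"
      unfolding C(2) N_def
      by (rule nn_integral_comp_le_of_Lipschitz[OF lipschitz_\<kappa>_inv \<kappa>_inv_\<kappa>]) measurable
    then have le1: "weighted_L2_norm h (H_weight G) (T_Lambda G h v)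
        \<le> ennreal C * weighted_L2_norm h (\<phi>_weight G) (FBI_real h v)"
      by (intro weighted_L2_norm_le C) (simp only: T S)
    \<comment> \<open>The reverse bound is the same estimate applied to the composition of
      \<open>F\<close> with \<kappa>, the two maps having exchanged roles.\<close>
    have "(\<integral>\<^sup>+p. ennreal (F (\<kappa> (\<kappa>_inv p))) \<partial>lborel)
        \<le> ennreal (C\<^sup>2) * (\<integral>\<^sup>+p. ennreal (F (\<kappa> p)) \<partial>lborel)"
      unfolding C(2) N_def
      by (rule nn_integral_comp_le_of_Lipschitz[OF lipschitz_\<kappa> \<kappa>_\<kappa>_inv]) measurable
    then show "weighted_L2_norm h (\<phi>_weight G) (FBI_real h v)
        \<le> ennreal C * weighted_L2_norm h (H_weight G) (T_Lambda G h v)"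
      by (intro weighted_L2_norm_le C) (simp only: T S \<kappa>_\<kappa>_inv)
    have "ennreal (1 / C) * weighted_L2_norm h (H_weight G) (T_Lambda G h v)
        \<le> ennreal (1 / C) * (ennreal C * weighted_L2_norm h (\<phi>_weight G) (FBI_real h v))"
      using le1 by (rule mult_left_mono) simp
    also have "\<dots> = weighted_L2_norm h (\<phi>_weight G) (FBI_real h v)"
      using C(1) by (simp add: mult.assoc[symmetric] ennreal_mult[symmetric])
    finally show "ennreal (1 / C) * weighted_L2_norm h (H_weight G) (T_Lambda G h v)
        \<le> weighted_L2_norm h (\<phi>_weight G) (FBI_real h v)" .
  qed
qed

end
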